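(* Let $c_1,c_2$ be distinct non-zero integers. Then $d_{(c_1,c_2)}(\mathbb{T})=1/2$, where $\mathbb{T}=\mathbb{R}/\mathbb{Z}$.
   Context: For non-zero integers $c_1,c_2$ and a compact abelian group $G$ with Haar probability measure $\mu$ on the Borel $\sigma$-algebra $\mathcal{B}_G$, a set $A\in\mathcal{B}_G$ is called $(c_1,c_2)$-free if there are no solutions $(x_1,x_2)\in A^2$ to the equation $c_1x_1=c_2x_2$. Define $d_{(c_1,c_2)}(G)=\sup\{\mu(A): A\subseteq G \text{ is } (c_1,c_2)\text{-free}\}$, the supremum being over Borel sets $A$. *)

theory Defs
  imports "HOL-Analysis.Analysis" "HOL-Probability.Probability_Measure"
begin

section \<open>Compact abelian groups and Haar probability measure\<close>

class compact_ab_group = topological_ab_group_add + t2_space +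
  assumes compact_UNIV_group: "compact (UNIV :: 'a set)"

text \<open>
  On a compact Hausdorff space, regularity of a finite Borel measure is equivalent to
  inner regularity by compact sets on all Borel sets, which is the last conjunct.
\<close>
definition haar_prob :: "'a::compact_ab_group measure \<Rightarrow> bool" where
  "haar_prob M \<longleftrightarrow> prob_space M \<and> sets M = sets borel \<and>
     (\<forall>a. \<forall>A\<in>sets borel. emeasure M ((+) a ` A) = emeasure M A) \<and>
     (\<forall>A\<in>sets borel. emeasure M A = (SUP K\<in>{K. K \<subseteq> A \<and> compact K}. emeasure M K))"

text \<open>
  Existence and uniqueness are proved below for the circle, so that the description is
  meaningful there (\<open>haar_circle\<close>).
\<close>
definition haar_measure :: "'a::compact_ab_group measure" where
  "haar_measure = (THE M. haar_prob M)"

section \<open>Free sets\<close>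

text \<open>The integer multiple \<open>c \<cdot> x\<close> in an abelian group.\<close>
definition zmul :: "int \<Rightarrow> 'a::ab_group_add \<Rightarrow> 'a" where
  "zmul c x = (if 0 \<le> c then (\<Sum>i<nat c. x) else - (\<Sum>i<nat (- c). x))"

definition eq_free :: "int \<Rightarrow> int \<Rightarrow> 'a::ab_group_add set \<Rightarrow> bool" where
  "eq_free c1 c2 A \<longleftrightarrow> \<not> (\<exists>x1\<in>A. \<exists>x2\<in>A. zmul c1 x1 = zmul c2 x2)"

definition d_free :: "int \<Rightarrow> int \<Rightarrow> 'a::compact_ab_group itself \<Rightarrow> real" where
  "d_free c1 c2 _ =
     Sup {measure haar_measure A | A :: 'a set. A \<in> sets borel \<and> eq_free c1 c2 A}"

text \<open>The supremum is over a nonempty set, as the empty set is free.\<close>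
lemma eq_free_empty: "eq_free c1 c2 {}"
  by (simp add: eq_free_def)

section \<open>The circle group\<close>

quotient_type circle = real / "\<lambda>x y::real. x - y \<in> \<int>"
proof (rule equivpI)
  show "reflp (\<lambda>x y::real. x - y \<in> \<int>)" by (simp add: reflp_def)
  show "symp (\<lambda>x y::real. x - y \<in> \<int>)"
    by (rule sympI) (metis Ints_minus minus_diff_eq)
  show "transp (\<lambda>x y::real. x - y \<in> \<int>)"
  proof (rule transpI)
    fix x y z :: real
    assume "x - y \<in> \<int>" "y - z \<in> \<int>"
    then have "(x - y) + (y - z) \<in> \<int>" by (rule Ints_add)
    then show "x - z \<in> \<int>" by simp
  qed
qed

lemma abs_circle_eq_iff: "abs_circle x = abs_circle y \<longleftrightarrow> x - y \<in> \<int>"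
  by (rule circle.abs_eq_iff)

lemma abs_circle_cases: obtains r where "x = abs_circle r"
  by (metis Quotient_abs_rep Quotient_circle)

instantiation circle :: ab_group_add
begin

lift_definition zero_circle :: circle is "0 :: real" .

lift_definition plus_circle :: "circle \<Rightarrow> circle \<Rightarrow> circle" is "(+) :: real \<Rightarrow> real \<Rightarrow> real"
proof -
  fix a b c d :: real
  assume "a - b \<in> \<int>" "c - d \<in> \<int>"
  then have "(a - b) + (c - d) \<in> \<int>" by (rule Ints_add)
  then show "a + c - (b + d) \<in> \<int>" by (simp add: algebra_simps)
qed

lift_definition uminus_circle :: "circle \<Rightarrow> circle" is "uminus :: real \<Rightarrow> real"
proof -
  fix a b :: real
  assume "a - b \<in> \<int>"
  then have "- (a - b) \<in> \<int>" by (rule Ints_minus)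
  then show "- a - - b \<in> \<int>" by simp
qed

lift_definition minus_circle :: "circle \<Rightarrow> circle \<Rightarrow> circle" is "(-) :: real \<Rightarrow> real \<Rightarrow> real"
proof -
  fix a b c d :: real
  assume "a - b \<in> \<int>" "c - d \<in> \<int>"
  then have "(a - b) - (c - d) \<in> \<int>" by (rule Ints_diff)
  then show "a - c - (b - d) \<in> \<int>" by (simp add: algebra_simps)
qed

instance
  by standard (transfer; simp add: algebra_simps)+

end

lemma abs_circle_sum: "(\<Sum>i<n. abs_circle x) = abs_circle (of_nat n * x)"
  by (induction n) (simp_all add: zero_circle.abs_eq plus_circle.abs_eq algebra_simps)

lemma zmul_abs_circle: "zmul c (abs_circle x) = abs_circle (of_int c * x)"
  by (simp add: zmul_def abs_circle_sum uminus_circle.abs_eq)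

text \<open>The quotient topology.\<close>
instantiation circle :: topological_space
begin

definition open_circle :: "circle set \<Rightarrow> bool" where
  "open_circle U \<longleftrightarrow> open (abs_circle -` U)"

instance
proof
  show "open (UNIV :: circle set)" by (simp add: open_circle_def)
  show "open (S \<inter> T)" if "open S" "open T" for S T :: "circle set"
    using that by (simp add: open_circle_def open_Int)
  show "open (\<Union>K)" if "\<forall>S\<in>K. open S" for K :: "circle set set"
    using that by (auto simp: open_circle_def vimage_Union)
qed

end

lemma continuous_on_abs_circle: "continuous_on A abs_circle"
  by (rule continuous_on_subset[of UNIV])
     (auto simp: continuous_on_open_vimage open_circle_def)

lemma open_abs_circle_image:
  assumes "open W"
  shows "open (abs_circle ` W)"
proof -
  have "abs_circle -` abs_circle ` W = (\<Union>n\<in>\<int>. (+) n ` W)"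
  proof (intro equalityI subsetI)
    fix x assume "x \<in> abs_circle -` abs_circle ` W"
    then obtain w where "w \<in> W" "x - w \<in> \<int>"
      by (auto simp: abs_circle_eq_iff)
    then show "x \<in> (\<Union>n\<in>\<int>. (+) n ` W)" by (intro UN_I[of "x - w"]) auto
  next
    fix x assume "x \<in> (\<Union>n\<in>\<int>. (+) n ` W)"
    then obtain n w where "n \<in> \<int>" "w \<in> W" "x = n + w" by auto
    then have "abs_circle x = abs_circle w" by (simp add: abs_circle_eq_iff)
    then show "x \<in> abs_circle -` abs_circle ` W" using \<open>w \<in> W\<close> by auto
  qed
  then show ?thesis
    using assms by (auto simp: open_circle_def intro!: open_translation)
qed

instance circle :: topological_ab_group_add
proof
  fix a b :: circle
  obtain r where r: "a = abs_circle r" by (rule abs_circle_cases)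
  obtain s where s: "b = abs_circle s" by (rule abs_circle_cases)
  show "LIM x (nhds a \<times>\<^sub>F nhds b). fst x + snd x :> nhds (a + b)"
  proof (rule topological_tendstoI)
    fix U assume U: "open U" "a + b \<in> U"
    have "open ((\<lambda>p :: real \<times> real. fst p + snd p) -` (abs_circle -` U))"
      using U(1) unfolding open_circle_def by (rule open_vimage) (intro continuous_intros)
    then have "open {p :: real \<times> real. fst p + snd p \<in> abs_circle -` U}"
      by (simp add: vimage_def)
    moreover have "(r, s) \<in> {p :: real \<times> real. fst p + snd p \<in> abs_circle -` U}"
      using U(2) by (simp add: r s plus_circle.abs_eq)
    ultimately obtain V W where VW: "open V" "open W" "r \<in> V" "s \<in> W"
      "V \<times> W \<subseteq> {p. fst p + snd p \<in> abs_circle -` U}"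
      by (elim open_prod_elim) auto
    show "\<forall>\<^sub>F x in nhds a \<times>\<^sub>F nhds b. fst x + snd x \<in> U"
      unfolding eventually_prod_filter
    proof (intro exI conjI allI impI)
      show "\<forall>\<^sub>F x in nhds a. x \<in> abs_circle ` V"
        using VW r open_abs_circle_image eventually_nhds by blast
      show "\<forall>\<^sub>F x in nhds b. x \<in> abs_circle ` W"
        using VW s open_abs_circle_image eventually_nhds by blast
      show "fst (x, y) + snd (x, y) \<in> U"
        if "x \<in> abs_circle ` V" "y \<in> abs_circle ` W" for x y
        using that VW(5) by (auto simp: plus_circle.abs_eq)
    qed
  qed
  show "(uminus \<longlongrightarrow> - a) (nhds a)"
  proof (rule topological_tendstoI)
    fix U assume U: "open U" "- a \<in> U"
    have "uminus -` U = abs_circle ` (uminus -` (abs_circle -` U))"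
    proof (intro equalityI subsetI)
      fix x assume x: "x \<in> uminus -` U"
      obtain t where "x = abs_circle t" by (rule abs_circle_cases)
      then show "x \<in> abs_circle ` (uminus -` (abs_circle -` U))"
        using x by (auto simp: uminus_circle.abs_eq)
    qed (auto simp: uminus_circle.abs_eq)
    moreover have "open (uminus -` (abs_circle -` U) :: real set)"
      using U(1) unfolding open_circle_def by (rule open_vimage) (intro continuous_intros)
    ultimately have "open (uminus -` U)" by (simp add: open_abs_circle_image)
    then show "\<forall>\<^sub>F x in nhds a. - x \<in> U"
      using U(2) by (auto simp: eventually_nhds intro!: exI[of _ "uminus -` U"])
  qed
qed

instance circle :: compact_ab_group
proof
  fix x y :: circle
  assume "x \<noteq> y"
  obtain r where r: "x = abs_circle r" by (rule abs_circle_cases)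
  obtain s where s: "y = abs_circle s" by (rule abs_circle_cases)
  have "r - s \<in> - \<int>" using \<open>x \<noteq> y\<close> by (simp add: r s abs_circle_eq_iff)
  moreover have "open (- \<int> :: real set)" by (simp add: open_Compl)
  ultimately obtain e where e: "e > 0" "ball (r - s) e \<subseteq> - \<int>"
    by (meson openE)
  show "\<exists>U V. open U \<and> open V \<and> x \<in> U \<and> y \<in> V \<and> U \<inter> V = {}"
  proof (intro exI conjI)
    show "open (abs_circle ` ball r (e/2))" "open (abs_circle ` ball s (e/2))"
      by (simp_all add: open_abs_circle_image)
    show "x \<in> abs_circle ` ball r (e/2)" "y \<in> abs_circle ` ball s (e/2)"
      using e(1) by (simp_all add: r s)
    show "abs_circle ` ball r (e/2) \<inter> abs_circle ` ball s (e/2) = {}"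
    proof (rule ccontr)
      assume "\<not> ?thesis"
      then obtain u v where uv: "u \<in> ball r (e/2)" "v \<in> ball s (e/2)" "u - v \<in> \<int>"
        by (auto simp: abs_circle_eq_iff)
      have "u - v \<in> ball (r - s) e" using uv(1,2) unfolding mem_ball dist_real_def by arith
      then show False using e(2) uv(3) by auto
    qed
  qed
next
  have "abs_circle ` {0..1} = UNIV"
  proof (intro equalityI subsetI)
    fix x :: circle
    obtain r where r: "x = abs_circle r" by (rule abs_circle_cases)
    have "x = abs_circle (frac r)" by (simp add: r abs_circle_eq_iff frac_def)
    then show "x \<in> abs_circle ` {0..1}"
      using frac_lt_1[of r] by (intro image_eqI[of _ _ "frac r"]) auto
  qed simp
  then show "compact (UNIV :: circle set)"
    by (metis compact_Icc compact_continuous_image continuous_on_abs_circle)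
qed

instance circle :: second_countable_topology
proof
  obtain B :: "real set set" where B: "countable B" "topological_basis B"
    using ex_countable_basis by blast
  have "topological_basis ((`) abs_circle ` B)"
  proof (rule topological_basisI)
    show "open V" if "V \<in> (`) abs_circle ` B" for V
      using that B(2) by (auto simp: topological_basis_open open_abs_circle_image)
    show "\<exists>V\<in>(`) abs_circle ` B. x \<in> V \<and> V \<subseteq> U" if U: "open U" "x \<in> U" for U x
    proof -
      obtain r where r: "x = abs_circle r" by (rule abs_circle_cases)
      obtain V where "V \<in> B" "r \<in> V" "V \<subseteq> abs_circle -` U"
        using topological_basisE[OF B(2), of "abs_circle -` U" r] U
        by (auto simp: open_circle_def r)
      then show ?thesis by (intro bexI[of _ "abs_circle ` V"]) (auto simp: r)
    qed
  qed
  then show "\<exists>B :: circle set set. countable B \<and> open = generate_topology B"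
    using B(1) topological_basis_imp_subbasis by blast
qed

section \<open>The Haar measure of the circle\<close>

definition circle_measure :: "circle measure" where
  "circle_measure = distr (uniform_measure lborel {0..<1}) borel abs_circle"

lemma measurable_abs_circle [measurable]: "abs_circle \<in> borel \<rightarrow>\<^sub>M borel"
  by (rule borel_measurable_continuous_onI) (rule continuous_on_abs_circle)

lemma emeasure_circle_measure:
  assumes "A \<in> sets borel"
  shows "emeasure circle_measure A = emeasure lborel (abs_circle -` A \<inter> {0..<1})"
proof -
  have "abs_circle -` A \<in> sets borel"
    using measurable_sets[OF measurable_abs_circle assms] by simp
  then show ?thesis
    using assms unfolding circle_measure_def
    by (subst emeasure_distr) (auto simp: Int_commute emeasure_uniform_measure divide_ennreal_def)
qed

lemma emeasure_lborel_vimage_plus: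
  fixes S :: "real set"
  assumes "S \<in> sets borel"
  shows "emeasure lborel ((+) t -` S) = emeasure lborel S"
proof -
  have "emeasure lborel S = emeasure (distr lborel borel ((+) t)) S"
    by (simp add: lborel_distr_plus)
  also have "\<dots> = emeasure lborel ((+) t -` S)"
    using assms by (subst emeasure_distr) auto
  finally show ?thesis ..
qed

lemma emeasure_periodic:
  fixes B :: "real set" and a :: real
  assumes B: "B \<in> sets borel" and per: "\<And>x n. n \<in> \<int> \<Longrightarrow> n + x \<in> B \<longleftrightarrow> x \<in> B"
  shows "emeasure lborel (B \<inter> {a..<a+1}) = emeasure lborel (B \<inter> {0..<1})"
proof -
  define n where "n = real_of_int \<lfloor>a\<rfloor>"
  have n: "n \<le> a" "a < n + 1" "n \<in> \<int>" by (auto simp: n_def)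
  have "emeasure lborel (B \<inter> {a..<a+1})
      = emeasure lborel (B \<inter> {a..<n+1} \<union> B \<inter> {n+1..<a+1})"
    using n by (intro arg_cong[where f = "emeasure lborel"]) auto
  also have "\<dots> = emeasure lborel (B \<inter> {a..<n+1}) + emeasure lborel (B \<inter> {n+1..<a+1})"
    using B by (subst plus_emeasure) auto
  also have "emeasure lborel (B \<inter> {n+1..<a+1})
      = emeasure lborel ((+) 1 -` (B \<inter> {n+1..<a+1}))"
    using B by (subst emeasure_lborel_vimage_plus) auto
  also have "(+) 1 -` (B \<inter> {n+1..<a+1}) = B \<inter> {n..<a}"
    using per[of 1] by auto
  also have "emeasure lborel (B \<inter> {a..<n+1}) + emeasure lborel (B \<inter> {n..<a})
      = emeasure lborel (B \<inter> {a..<n+1} \<union> B \<inter> {n..<a})"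
    using B by (subst plus_emeasure) auto
  also have "B \<inter> {a..<n+1} \<union> B \<inter> {n..<a} = B \<inter> {n..<n+1}"
    using n by auto
  also have "emeasure lborel (B \<inter> {n..<n+1}) = emeasure lborel ((+) n -` (B \<inter> {n..<n+1}))"
    using B by (subst emeasure_lborel_vimage_plus) auto
  also have "(+) n -` (B \<inter> {n..<n+1}) = B \<inter> {0..<1}"
    using per[OF n(3)] by auto
  finally show ?thesis .
qed

lemma image_plus_group: "(+) a ` A = (+) (- a) -` (A :: 'a::group_add set)"
proof (intro equalityI subsetI)
  fix x assume "x \<in> (+) (- a) -` A"
  then show "x \<in> (+) a ` A" by (intro image_eqI[of _ _ "- a + x"]) (auto simp: add.assoc[symmetric])
qed (auto simp: add.assoc[symmetric])

lemma sets_circle_translate: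
  fixes A :: "circle set"
  assumes "A \<in> sets borel"
  shows "(+) a -` A \<in> sets borel"
proof -
  have "(+) a \<in> borel \<rightarrow>\<^sub>M borel"
    by (intro borel_measurable_continuous_onI continuous_intros)
  from measurable_sets[OF this assms] show ?thesis by simp
qed

lemma circle_measure_invariant:
  assumes A: "A \<in> sets borel"
  shows "emeasure circle_measure ((+) a ` A) = emeasure circle_measure A"
proof -
  obtain t where t: "- a = abs_circle t" by (rule abs_circle_cases)
  let ?B = "abs_circle -` A"
  have B: "?B \<in> sets borel"
    using measurable_sets[OF measurable_abs_circle A] by simp
  have per: "n + x \<in> ?B \<longleftrightarrow> x \<in> ?B" if "n \<in> \<int>" for n x
  proof -
    have "abs_circle (n + x) = abs_circle x" using that by (simp add: abs_circle_eq_iff)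
    then show ?thesis by simp
  qed
  have "emeasure circle_measure ((+) a ` A)
      = emeasure lborel (abs_circle -` ((+) (- a) -` A) \<inter> {0..<1})"
    unfolding image_plus_group by (rule emeasure_circle_measure) (rule sets_circle_translate[OF A])
  also have "abs_circle -` ((+) (- a) -` A) \<inter> {0..<1} = (+) t -` (?B \<inter> {t..<t+1})"
    unfolding t by (auto simp: plus_circle.abs_eq)
  also have "emeasure lborel \<dots> = emeasure lborel (?B \<inter> {t..<t+1})"
    using B by (intro emeasure_lborel_vimage_plus) auto
  also have "\<dots> = emeasure lborel (?B \<inter> {0..<1})"
    by (rule emeasure_periodic[OF B per])
  finally show ?thesis by (simp add: emeasure_circle_measure[OF A])
qed

lemma prob_space_circle_measure: "prob_space circle_measure"
  unfolding circle_measure_def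
  by (intro prob_space.prob_space_distr prob_space_uniform_measure) auto

lemma circle_measure_inner_regular:
  assumes A: "A \<in> sets borel"
  shows "emeasure circle_measure A = (SUP K\<in>{K. K \<subseteq> A \<and> compact K}. emeasure circle_measure K)"
    (is "_ = ?S")
proof (rule antisym)
  let ?M = "uniform_measure lborel {0..<1::real}"
  let ?B = "abs_circle -` A"
  have B: "?B \<in> sets borel"
    using measurable_sets[OF measurable_abs_circle A] by simp
  interpret U: prob_space ?M by (intro prob_space_uniform_measure) auto
  have distr: "emeasure circle_measure C = emeasure ?M (abs_circle -` C)"
    if "C \<in> sets borel" for C
    using that unfolding circle_measure_def by (subst emeasure_distr) auto
  have "emeasure circle_measure A = emeasure ?M ?B" by (rule distr[OF A])
  also have "\<dots> = (SUP K\<in>{K. K \<subseteq> ?B \<and> compact K}. emeasure ?M K)"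
    using B U.emeasure_finite by (intro inner_regular) auto
  also have "\<dots> \<le> ?S"
  proof (rule SUP_mono)
    fix K assume K: "K \<in> {K. K \<subseteq> ?B \<and> compact K}"
    then have c: "compact (abs_circle ` K)"
      using compact_continuous_image continuous_on_abs_circle by auto
    then have s: "abs_circle ` K \<in> sets borel" by (simp add: compact_imp_closed)
    have "abs_circle -` abs_circle ` K \<in> sets borel"
      using measurable_sets[OF measurable_abs_circle s] by simp
    then have "emeasure ?M K \<le> emeasure circle_measure (abs_circle ` K)"
      unfolding distr[OF s] by (intro emeasure_mono) auto
    then show "\<exists>L\<in>{K. K \<subseteq> A \<and> compact K}. emeasure ?M K \<le> emeasure circle_measure L"
      using K c by (intro bexI[of _ "abs_circle ` K"]) auto
  qed
  finally show "emeasure circle_measure A \<le> ?S" .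
  show "?S \<le> emeasure circle_measure A"
    using A by (intro SUP_least emeasure_mono) (auto simp: circle_measure_def)
qed

lemma haar_prob_circle_measure: "haar_prob circle_measure"
  unfolding haar_prob_def
  using prob_space_circle_measure circle_measure_invariant circle_measure_inner_regular
  by (auto simp: circle_measure_def)

lemma haar_prob_circle_unique:
  fixes M N :: "circle measure"
  assumes M: "haar_prob M" and N: "haar_prob N"
  shows "M = N"
proof (rule measure_eqI)
  have sM [measurable_cong]: "sets M = sets borel" and sN [measurable_cong]: "sets N = sets borel"
    using M N by (auto simp: haar_prob_def)
  show "sets M = sets N" by (simp add: sM sN)
  interpret M: prob_space M using M by (simp add: haar_prob_def)
  interpret N: prob_space N using N by (simp add: haar_prob_def)
  interpret P: pair_sigma_finite M N ..
  have inv: "emeasure L ((+) a -` A) = emeasure L A"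
    if "haar_prob L" "A \<in> sets borel" for L :: "circle measure" and a A
  proof -
    have "emeasure L ((+) (- a) ` A) = emeasure L A"
      using that unfolding haar_prob_def by blast
    then show ?thesis unfolding image_plus_group by simp
  qed
  fix A assume "A \<in> sets M"
  then have A [measurable]: "A \<in> sets borel" by (simp add: sM)
  have ind: "(\<integral>\<^sup>+ x. indicator A (y + x) \<partial>L) = emeasure L A"
    if L: "haar_prob L" for L :: "circle measure" and y
  proof -
    have "sets L = sets borel" using L by (simp add: haar_prob_def)
    have "(\<integral>\<^sup>+ x. indicator A (y + x) \<partial>L) = (\<integral>\<^sup>+ x. indicator ((+) y -` A) x \<partial>L)"
      by (intro nn_integral_cong) (auto simp: indicator_def)
    also have "\<dots> = emeasure L ((+) y -` A)"
      by (rule nn_integral_indicator) (simp add: \<open>sets L = sets borel\<close> sets_circle_translate)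
    finally show ?thesis by (simp add: inv[OF L A])
  qed
  have "emeasure M A = (\<integral>\<^sup>+ y. (\<integral>\<^sup>+ x. indicator A (y + x) \<partial>M) \<partial>N)"
    by (simp add: ind[OF M] N.emeasure_space_1)
  also have "\<dots> = (\<integral>\<^sup>+ x. (\<integral>\<^sup>+ y. indicator A (y + x) \<partial>N) \<partial>M)"
    by (rule P.Fubini') measurable
  also have "\<dots> = emeasure N A"
    by (subst add.commute) (simp add: ind[OF N] M.emeasure_space_1)
  finally show "emeasure M A = emeasure N A" .
qed

lemma haar_circle: "(haar_measure :: circle measure) = circle_measure"
  unfolding haar_measure_def
  using haar_prob_circle_measure haar_prob_circle_unique by (intro the_equality) auto

end

theory Submission
  imports Defs
begin

text \<open>
  Write \<open>T\<^sub>c\<close> for multiplication by \<open>c\<close>; it preserves Haar measure for \<open>c \<noteq> 0\<close>.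
  If \<open>A\<close> is free, the preimages of \<open>A\<close> under \<open>T\<^sub>c\<^sub>1\<close> and \<open>T\<^sub>c\<^sub>2\<close> are disjoint, so \<open>A\<close> has
  measure at most \<open>1/2\<close>.

  For the lower bound, taking a preimage under \<open>T\<^sub>g\<close> with \<open>g\<close> the gcd reduces to coprime \<open>a, b\<close>,
  whose solutions are exactly \<open>(b t, a t)\<close>. The case \<open>b = - a\<close> is solved by the open half circle.
  If \<open>\<bar>a\<bar> < \<bar>b\<bar>\<close>, one imitates a Rokhlin tower for the map \<open>b/a\<close>: with the points
  \<open>y\<^sub>i(x) = a^(n-i) b^i x\<close> we have \<open>y\<^sub>i\<^sub>+\<^sub>1(a t) = y\<^sub>i(b t)\<close>, so if \<open>A\<close> consists of the \<open>x\<close> for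
  which the first \<open>i \<le> n\<close> with \<open>y\<^sub>i(x)\<close> in a fixed arc \<open>B\<close> is odd, then \<open>a t \<in> A\<close> makes the first
  such index for \<open>b t\<close> even and \<open>A\<close> is free. Up to the measure of \<open>B\<close>, the odd case is as likely
  as the even one. For \<open>B\<close> of length \<open>\<bar>b\<bar>^(-m)\<close>, the probability of never hitting
  \<open>B\<close> decreases by a factor \<open>1 - \<bar>b\<bar>^(-m)\<close> whenever \<open>n\<close> grows by \<open>m\<close>.
\<close>

section \<open>Integer multiplication on the circle\<close>

lemma zmul_zmul: "zmul c (zmul d (x :: circle)) = zmul (c * d) x"
  by (cases x rule: abs_circle_cases) (simp add: zmul_abs_circle mult.assoc)

lemma zmul_add_right: "zmul c (x + y :: circle) = zmul c x + zmul c y"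
proof -
  obtain r s where "x = abs_circle r" "y = abs_circle s"
    by (metis abs_circle_cases)
  then show ?thesis by (simp add: plus_circle.abs_eq zmul_abs_circle distrib_left)
qed

lemma zmul_add_left: "zmul (c + d) (x :: circle) = zmul c x + zmul d x"
  by (cases x rule: abs_circle_cases)
     (simp add: plus_circle.abs_eq zmul_abs_circle distrib_right)

lemma zmul_1: "zmul 1 (x :: circle) = x"
  by (cases x rule: abs_circle_cases) (simp add: zmul_abs_circle)

lemma surj_zmul:
  assumes "c \<noteq> 0"
  obtains y where "x = zmul c (y :: circle)"
proof -
  obtain r where "x = abs_circle r" by (rule abs_circle_cases)
  then have "x = zmul c (abs_circle (r / of_int c))"
    using assms by (simp add: zmul_abs_circle)
  then show thesis by (rule that)
qed

lemma measurable_zmul [measurable]: "zmul c \<in> (borel :: circle measure) \<rightarrow>\<^sub>M borel"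
  unfolding zmul_def by (intro borel_measurable_continuous_onI) (cases "0 \<le> c"; simp; intro continuous_intros)

text \<open>The parameter is a Bezout combination of \<open>x\<close> and \<open>y\<close>; trading
  \<open>zmul b y\<close> for \<open>zmul a x\<close>, or back, collects the coefficient
  \<open>u * a + v * b = 1\<close>.\<close>

lemma zmul_eq_param:
  assumes "coprime a b" "zmul a x = zmul b (y :: circle)"
  obtains t where "x = zmul b t" "y = zmul a t"
proof -
  obtain u v where uv: "u * a + v * b = 1"
    using bezout_int[of a b] assms(1) by auto
  define t where "t = zmul v x + zmul u y"
  have "zmul b t = zmul (v * b) x + zmul u (zmul b y)"
    by (simp add: t_def zmul_add_right zmul_zmul mult.commute)
  also have "\<dots> = zmul (u * a + v * b) x"
    by (simp add: assms(2)[symmetric] zmul_zmul zmul_add_left add.commute)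
  finally have x: "x = zmul b t" by (simp add: uv zmul_1)
  have "zmul a t = zmul v (zmul a x) + zmul (u * a) y"
    by (simp add: t_def zmul_add_right zmul_zmul mult.commute)
  also have "\<dots> = zmul (u * a + v * b) y"
    by (simp add: assms(2) zmul_zmul zmul_add_left add.commute)
  finally have "y = zmul a t" by (simp add: uv zmul_1)
  with x show thesis by (rule that)
qed

section \<open>Integer multiplication preserves Haar measure\<close>

interpretation circle: prob_space circle_measure
  by (rule prob_space_circle_measure)

lemma sets_circle_measure [measurable_cong, simp]: "sets circle_measure = sets borel"
  by (simp add: circle_measure_def)

lemma space_circle_measure [simp]: "space circle_measure = UNIV"
  by (simp add: circle_measure_def)

lemma emeasure_circle_translate:
  assumes "A \<in> sets borel"
  shows "emeasure circle_measure ((+) a -` A) = emeasure circle_measure A"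
  using circle_measure_invariant[OF assms, of "- a"] unfolding image_plus_group by simp

text \<open>Fubini applied to \<open>1\<^sub>A (x + c \<cdot> y)\<close>: integrating first over either variable
  gives a constant, by translation invariance and divisibility of the circle.\<close>
lemma emeasure_zmul_vimage:
  assumes c: "c \<noteq> 0" and A [measurable]: "A \<in> sets borel"
  shows "emeasure circle_measure (zmul c -` A) = emeasure circle_measure A"
proof -
  interpret P: pair_sigma_finite circle_measure circle_measure ..
  have ZA: "zmul c -` A \<in> sets borel"
    using measurable_sets[OF measurable_zmul A] by simp
  have 1: "(\<integral>\<^sup>+ x. indicator A (zmul c y + x) \<partial>circle_measure) = emeasure circle_measure A" for y
  proof -
    have "(\<integral>\<^sup>+ x. indicator A (zmul c y + x) \<partial>circle_measure)
        = (\<integral>\<^sup>+ x. indicator ((+) (zmul c y) -` A) x \<partial>circle_measure)"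
      by (intro nn_integral_cong) (auto simp: indicator_def)
    also have "\<dots> = emeasure circle_measure ((+) (zmul c y) -` A)"
      by (rule nn_integral_indicator) (simp add: sets_circle_translate)
    finally show ?thesis by (simp add: emeasure_circle_translate)
  qed
  have 2: "(\<integral>\<^sup>+ y. indicator A (zmul c y + x) \<partial>circle_measure)
      = emeasure circle_measure (zmul c -` A)" for x
  proof -
    obtain z where z: "x = zmul c z" using surj_zmul[OF c] .
    have "(\<integral>\<^sup>+ y. indicator A (zmul c y + x) \<partial>circle_measure)
        = (\<integral>\<^sup>+ y. indicator ((+) z -` zmul c -` A) y \<partial>circle_measure)"
      by (intro nn_integral_cong) (auto simp: indicator_def z zmul_add_right add.commute)
    also have "\<dots> = emeasure circle_measure ((+) z -` zmul c -` A)"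
      by (rule nn_integral_indicator) (simp add: sets_circle_translate ZA)
    finally show ?thesis by (simp add: emeasure_circle_translate ZA)
  qed
  have "emeasure circle_measure A
      = (\<integral>\<^sup>+ y. (\<integral>\<^sup>+ x. indicator A (zmul c y + x) \<partial>circle_measure) \<partial>circle_measure)"
    using circle.emeasure_space_1 by (simp add: 1)
  also have "\<dots> = (\<integral>\<^sup>+ x. (\<integral>\<^sup>+ y. indicator A (zmul c y + x) \<partial>circle_measure) \<partial>circle_measure)"
    by (rule P.Fubini') measurable
  also have "\<dots> = emeasure circle_measure (zmul c -` A)"
    using circle.emeasure_space_1 by (simp add: 2)
  finally show ?thesis ..
qed

lemma sets_zmul_vimage:
  assumes "A \<in> sets borel"
  shows "zmul c -` (A :: circle set) \<in> sets borel"
  using measurable_sets[OF measurable_zmul assms] by simp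

lemma prob_zmul_vimage:
  assumes "c \<noteq> 0" "A \<in> sets borel"
  shows "circle.prob (zmul c -` A) = circle.prob A"
  using emeasure_zmul_vimage[OF assms] by (simp add: measure_def)

section \<open>The upper bound\<close>

lemma eq_free_prob_le:
  assumes "c1 \<noteq> 0" "c2 \<noteq> 0" "A \<in> sets borel" "eq_free c1 c2 A"
  shows "circle.prob A \<le> 1 / 2"
proof -
  have disj: "zmul c1 -` A \<inter> zmul c2 -` A = {}"
  proof (rule equals0I)
    fix t assume "t \<in> zmul c1 -` A \<inter> zmul c2 -` A"
    \<comment> \<open>The pair \<open>(zmul c2 t, zmul c1 t)\<close> is a solution inside
      \<open>A\<close>.\<close>
    moreover have "zmul c1 (zmul c2 t) = zmul c2 (zmul c1 t)"
      by (simp add: zmul_zmul mult.commute)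
    ultimately show False using assms(4) by (auto simp: eq_free_def)
  qed
  have "2 * circle.prob A = circle.prob (zmul c1 -` A) + circle.prob (zmul c2 -` A)"
    using assms by (simp add: prob_zmul_vimage)
  also have "\<dots> = circle.prob (zmul c1 -` A \<union> zmul c2 -` A)"
    using assms disj by (intro circle.finite_measure_Union[symmetric]) (auto intro: sets_zmul_vimage)
  also have "\<dots> \<le> 1" by (rule circle.prob_le_1)
  finally show ?thesis by simp
qed

section \<open>Short arcs and the probability of avoiding them\<close>

definition arc :: "real \<Rightarrow> circle set" where
  "arc d = abs_circle ` {0..d}"

lemma sets_arc [measurable]: "arc d \<in> sets borel"
  unfolding arc_def
  by (intro borel_closed compact_imp_closed compact_continuous_image continuous_on_abs_circle) auto

text \<open>As \<open>d < 1\<close>, representatives of one point in \<open>{0..<1}\<close> and in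
  \<open>{0..d}\<close> differ by an integer of absolute value below 1, hence agree.\<close>

lemma prob_arc_le:
  assumes "0 \<le> d" "d < 1"
  shows "circle.prob (arc d) \<le> d"
proof -
  have "abs_circle -` arc d \<inter> {0..<1} \<subseteq> {0..d}"
  proof
    fix x assume "x \<in> abs_circle -` arc d \<inter> {0..<1}"
    then obtain r where r: "x - r \<in> \<int>" "0 \<le> r" "r \<le> d" "0 \<le> x" "x < 1"
      by (auto simp: arc_def abs_circle_eq_iff)
    then obtain k where k: "x - r = of_int k" by (auto elim: Ints_cases)
    then have "\<bar>real_of_int k\<bar> < 1" using r assms by linarith
    then have "k = 0" by linarith
    then show "x \<in> {0..d}" using r k by simp
  qed
  then have "emeasure circle_measure (arc d) \<le> emeasure lborel {0..d}"
    unfolding emeasure_circle_measure[OF sets_arc] by (intro emeasure_mono) auto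
  then show ?thesis
    using assms by (simp add: circle.emeasure_eq_measure)
qed

text \<open>Since \<open>p\<close> is a unit modulo \<open>|q|\<close>, the points
  \<open>p k / |q|\<close> run through all multiples of \<open>1 / |q|\<close>, and one of them
  carries \<open>y\<close> into the arc.\<close>

lemma arc_covers:
  assumes p: "coprime p q" and q: "q \<noteq> 0"
  obtains k where "k < nat \<bar>q\<bar>" "zmul p (abs_circle (of_nat k / \<bar>of_int q\<bar>)) + y \<in> arc (1 / \<bar>of_int q\<bar>)"
proof -
  define Q where "Q = \<bar>q\<bar>"
  have Q: "Q > 0" "coprime p Q" using assms by (auto simp: Q_def)
  obtain r where r: "y = abs_circle r" by (rule abs_circle_cases)
  define j where "j = \<lfloor>of_int Q * r\<rfloor>"
  obtain u v where uv: "u * p + v * Q = 1" using bezout_int[of p Q] Q by auto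
  \<comment> \<open>\<open>u\<close> inverts \<open>p\<close> modulo \<open>Q\<close>, so
    \<open>p * k\<close> is congruent to \<open>- j\<close>: adding \<open>p k / Q\<close> amounts
    to subtracting \<open>j / Q\<close> on the circle.\<close>
  define k where "k = (- j * u) mod Q"
  have k: "0 \<le> k" "k < Q" using Q by (auto simp: k_def)
  have "p * k + j = p * (- j * u - Q * ((- j * u) div Q)) + j * (u * p + v * Q)"
    by (simp add: k_def uv minus_mult_div_eq_mod)
  also have "\<dots> = Q * (j * v - p * ((- j * u) div Q))"
    by (simp add: algebra_simps)
  finally obtain l where l: "p * k + j = Q * l" by blast
  have "real_of_int p * (k / Q) + r - (r - j / Q) = of_int (p * k + j) / Q"
    using Q by (simp add: field_simps)
  also have "\<dots> = of_int l" using Q l by simp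
  finally have "zmul p (abs_circle (k / Q)) + y = abs_circle (r - j / Q)"
    by (simp add: r zmul_abs_circle plus_circle.abs_eq abs_circle_eq_iff)
  moreover have "r - j / Q \<in> {0..1 / Q}"
  proof -
    have "r - j / Q = (Q * r - j) / Q" using Q by (simp add: field_simps)
    moreover have "0 \<le> Q * r - j" "Q * r - j \<le> 1" by (simp_all add: j_def) linarith
    ultimately show ?thesis using Q by (simp add: divide_right_mono)
  qed
  ultimately have "zmul p (abs_circle (k / Q)) + y \<in> arc (1 / Q)"
    by (simp add: arc_def)
  with k show thesis by (intro that[of "nat k"]) (auto simp: Q_def)
qed

text \<open>The event \<open>q \<cdot> x \<in> D\<close> is invariant under translation by \<open>1 / q\<close>, and the
  translates of the event \<open>p \<cdot> x \<in> arc (1 / \<bar>q\<bar>)\<close> by multiples of \<open>1 / q\<close> cover the circle.\<close>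
lemma prob_avoid_arc_le:
  assumes p: "coprime p q" and q: "q \<noteq> 0" and D: "D \<in> sets borel"
  shows "circle.prob {x. zmul p x \<notin> arc (1 / \<bar>of_int q\<bar>) \<and> zmul q x \<in> D}
      \<le> (1 - 1 / \<bar>of_int q\<bar>) * circle.prob D"
proof -
  define B where "B = arc (1 / \<bar>of_int q\<bar>)"
  define Z where "Z = zmul q -` D"
  define E where "E = zmul p -` B \<inter> Z"
  have sets [measurable]: "Z \<in> sets borel" "B \<in> sets borel" "E \<in> sets borel"
    by (auto simp: Z_def B_def E_def intro!: sets.Int[where M = borel] sets_zmul_vimage D)
  define s where "s k = abs_circle (of_nat k / \<bar>of_int q\<bar>)" for k
  have s: "zmul q (s k + x) = zmul q x" for k x
  proof -
    have "real_of_int q * (k / \<bar>real_of_int q\<bar>) \<in> \<int>"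
      using q by (cases "q > 0") (auto simp: abs_if)
    then have "zmul q (s k) = 0"
      by (simp add: s_def zmul_abs_circle zero_circle.abs_eq abs_circle_eq_iff)
    then show ?thesis by (simp add: zmul_add_right)
  qed
  have "Z \<subseteq> (\<Union>k<nat \<bar>q\<bar>. (+) (s k) -` E)"
  proof
    fix x assume x: "x \<in> Z"
    obtain k where "k < nat \<bar>q\<bar>" "zmul p (s k) + zmul p x \<in> B"
      using arc_covers[OF p q] unfolding s_def B_def .
    then show "x \<in> (\<Union>k<nat \<bar>q\<bar>. (+) (s k) -` E)"
      using x by (intro UN_I[of k]) (auto simp: E_def Z_def s zmul_add_right[of p])
  qed
  then have "circle.prob Z \<le> circle.prob (\<Union>k<nat \<bar>q\<bar>. (+) (s k) -` E)"
    by (intro circle.finite_measure_mono) (simp_all add: sets.finite_UN sets_circle_translate)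
  also have "\<dots> \<le> (\<Sum>k<nat \<bar>q\<bar>. circle.prob ((+) (s k) -` E))"
    by (intro circle.finite_measure_subadditive_finite) (auto intro: sets_circle_translate)
  also have "\<dots> = \<bar>of_int q\<bar> * circle.prob E"
    by (simp add: measure_def emeasure_circle_translate)
  finally have *: "circle.prob Z / \<bar>of_int q\<bar> \<le> circle.prob E"
    using q by (simp add: field_simps)
  have "circle.prob {x. zmul p x \<notin> B \<and> zmul q x \<in> D} = circle.prob (Z - E)"
    by (rule arg_cong[where f = circle.prob]) (auto simp: Z_def E_def)
  also have "\<dots> = circle.prob Z - circle.prob E"
    by (rule circle.finite_measure_Diff) (auto simp: E_def)
  also have "\<dots> \<le> circle.prob Z - circle.prob Z / \<bar>of_int q\<bar>"
    using * by simp
  also have "\<dots> = (1 - 1 / \<bar>of_int q\<bar>) * circle.prob D"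
    using q by (simp add: Z_def prob_zmul_vimage D algebra_simps)
  finally show ?thesis unfolding B_def .
qed

section \<open>First hitting indices and their parity\<close>

text \<open>The factor is \<open>(b/a)^i\<close> scaled by \<open>a^n\<close>: division by
  \<open>a\<close> is multivalued on the circle in general, so denominators are cleared. Only
  indices \<open>i \<le> n\<close> enter the definitions below, so the subtraction never truncates
  there.\<close>

definition orbit_pt :: "int \<Rightarrow> int \<Rightarrow> nat \<Rightarrow> nat \<Rightarrow> circle \<Rightarrow> circle" where
  "orbit_pt a b n i x = zmul (a ^ (n - i) * b ^ i) x"

definition first_hit :: "int \<Rightarrow> int \<Rightarrow> nat \<Rightarrow> circle set \<Rightarrow> nat \<Rightarrow> circle \<Rightarrow> bool" where
  "first_hit a b n B k x \<longleftrightarrow> k \<le> n \<and> orbit_pt a b n k x \<in> B \<and> (\<forall>i<k. orbit_pt a b n i x \<notin> B)"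

definition no_hit :: "int \<Rightarrow> int \<Rightarrow> nat \<Rightarrow> circle set \<Rightarrow> circle set" where
  "no_hit a b n B = {x. \<forall>k\<le>n. orbit_pt a b n k x \<notin> B}"

definition parity_hit :: "int \<Rightarrow> int \<Rightarrow> nat \<Rightarrow> circle set \<Rightarrow> bool \<Rightarrow> circle set" where
  "parity_hit a b n B e = {x. \<exists>k. even k = e \<and> first_hit a b n B k x}"

lemma measurable_orbit_pt [measurable]: "orbit_pt a b n i \<in> borel \<rightarrow>\<^sub>M borel"
  unfolding orbit_pt_def by measurable

lemma sets_no_hit:
  assumes [measurable]: "B \<in> sets borel"
  shows "no_hit a b n B \<in> sets borel"
  unfolding no_hit_def by measurable

lemma sets_parity_hit:
  assumes [measurable]: "B \<in> sets borel"
  shows "parity_hit a b n B e \<in> sets borel"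
  unfolding parity_hit_def first_hit_def by measurable

text \<open>Both sides multiply \<open>t\<close> by \<open>a^(n-i) * b^(i+1)\<close>;
  \<open>i < n\<close> leaves a factor \<open>a\<close> to move.\<close>

lemma orbit_pt_shift: "i < n \<Longrightarrow> orbit_pt a b n (Suc i) (zmul a t) = orbit_pt a b n i (zmul b t)"
  by (simp add: orbit_pt_def zmul_zmul Suc_diff_Suc[symmetric] mult_ac)

lemma first_hit_unique: "first_hit a b n B k x \<Longrightarrow> first_hit a b n B l x \<Longrightarrow> k = l"
  unfolding first_hit_def by (metis linorder_neqE_nat)

text \<open>The orbit of \<open>a t\<close> is that of \<open>b t\<close> delayed by one index, with
  a new initial point and without the last point.\<close>

lemma first_hit_Suc:
  "first_hit a b n B (Suc k) (zmul a t) \<longleftrightarrow>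
    k < n \<and> first_hit a b n B k (zmul b t) \<and> orbit_pt a b n 0 (zmul a t) \<notin> B"
  unfolding first_hit_def by (auto simp: orbit_pt_shift less_Suc_eq_0_disj)

lemma eq_free_parity_hit:
  assumes "coprime a b"
  shows "eq_free a b (parity_hit a b n B False)"
  unfolding eq_free_def
proof safe
  fix x y assume xy: "x \<in> parity_hit a b n B False" "y \<in> parity_hit a b n B False"
    and eq: "zmul a x = zmul b y"
  obtain t where t: "x = zmul b t" "y = zmul a t" using zmul_eq_param[OF assms eq] .
  obtain k where k: "odd k" "first_hit a b n B k (zmul a t)"
    using xy(2) by (auto simp: parity_hit_def t)
  obtain l where l: "odd l" "first_hit a b n B l (zmul b t)"
    using xy(1) by (auto simp: parity_hit_def t)
  obtain j where j: "k = Suc j" "even j" using k(1) by (cases k) auto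
  \<comment> \<open>The shift makes \<open>j\<close> a first hit for \<open>b t\<close>, as
    \<open>l\<close> is, but their parities differ.\<close>
  have "j = l" using k(2) l(2) unfolding j first_hit_Suc by (auto dest: first_hit_unique)
  then show False using j l by simp
qed

text \<open>An even first hit for \<open>b t\<close> becomes an odd one for \<open>a t\<close>
  unless the new initial point \<open>a^(n+1) t\<close> lies in \<open>B\<close>. Invariance of the
  measure then bounds the even case by the odd one plus \<open>B\<close>.\<close>

lemma prob_parity_hit:
  assumes a: "a \<noteq> 0" and b: "b \<noteq> 0" and n: "odd n" and B: "B \<in> sets borel"
  shows "1 \<le> 2 * circle.prob (parity_hit a b n B False) + circle.prob B
    + circle.prob (no_hit a b n B)"
proof -
  let ?H = "parity_hit a b n B" and ?N = "no_hit a b n B"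
  have "zmul b -` ?H True \<subseteq> zmul a -` ?H False \<union> zmul (a ^ Suc n) -` B"
  proof
    fix t assume "t \<in> zmul b -` ?H True"
    then obtain k where k: "even k" "first_hit a b n B k (zmul b t)"
      by (auto simp: parity_hit_def)
    \<comment> \<open>An even \<open>k\<close> is not the odd last index \<open>n\<close>, so
      \<open>Suc k\<close> is still in range.\<close>
    have "k < n" using k n by (auto simp: first_hit_def le_less)
    then have "first_hit a b n B (Suc k) (zmul a t)" if "zmul (a ^ Suc n) t \<notin> B"
      using k that by (simp add: first_hit_Suc) (simp add: orbit_pt_def zmul_zmul mult.commute)
    then show "t \<in> zmul a -` ?H False \<union> zmul (a ^ Suc n) -` B"
      using k(1) unfolding parity_hit_def by (auto intro!: exI[of _ "Suc k"])
  qed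
  then have "circle.prob (zmul b -` ?H True)
      \<le> circle.prob (zmul a -` ?H False \<union> zmul (a ^ Suc n) -` B)"
    by (intro circle.finite_measure_mono) (auto intro!: sets_zmul_vimage sets_parity_hit B)
  also have "\<dots> \<le> circle.prob (zmul a -` ?H False) + circle.prob (zmul (a ^ Suc n) -` B)"
    by (rule measure_Un_le) (auto intro!: sets_zmul_vimage sets_parity_hit B)
  finally have even: "circle.prob (?H True) \<le> circle.prob (?H False) + circle.prob B"
    using a b by (simp add: prob_zmul_vimage sets_parity_hit B del: power_Suc)
  have "x \<in> ?H True \<union> ?H False \<union> ?N" for x
  proof (cases "x \<in> ?N")
    case False
    then obtain k where "k \<le> n" "orbit_pt a b n k x \<in> B" by (auto simp: no_hit_def)
    moreover define l where "l = (LEAST k. orbit_pt a b n k x \<in> B)"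
    ultimately have "first_hit a b n B l x"
      unfolding first_hit_def by (metis LeastI Least_le le_trans not_less_Least)
    then show ?thesis unfolding parity_hit_def by auto
  qed simp
  then have "?H True \<union> ?H False \<union> ?N = UNIV" by blast
  then have "1 = circle.prob (?H True \<union> ?H False \<union> ?N)"
    using circle.prob_space by simp
  also have "\<dots> \<le> circle.prob (?H True \<union> ?H False) + circle.prob ?N"
    by (rule measure_Un_le) (auto intro!: sets_no_hit sets_parity_hit B)
  also have "circle.prob (?H True \<union> ?H False) \<le> circle.prob (?H True) + circle.prob (?H False)"
    by (rule measure_Un_le) (auto intro!: sets_parity_hit B)
  finally show ?thesis using even by simp
qed

text \<open>The orbit of \<open>a x\<close> for \<open>n\<close> is an initial segment of the orbit
  of \<open>x\<close> for \<open>n + 1\<close>. This allows passing to an odd length later.\<close>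

lemma prob_no_hit_Suc_le:
  assumes "a \<noteq> 0" "B \<in> sets borel"
  shows "circle.prob (no_hit a b (Suc n) B) \<le> circle.prob (no_hit a b n B)"
proof -
  have "orbit_pt a b n k (zmul a x) = orbit_pt a b (Suc n) k x" if "k \<le> n" for k x
    using that by (simp add: orbit_pt_def zmul_zmul Suc_diff_le mult_ac)
  then have "no_hit a b (Suc n) B \<subseteq> zmul a -` no_hit a b n B"
    by (auto simp: no_hit_def)
  then have "circle.prob (no_hit a b (Suc n) B) \<le> circle.prob (zmul a -` no_hit a b n B)"
    by (rule circle.finite_measure_mono) (auto intro!: sets_zmul_vimage sets_no_hit assms)
  then show ?thesis using assms by (simp add: prob_zmul_vimage sets_no_hit)
qed

text \<open>Among the first \<open>m\<close> indices only index 0 is kept; the indices from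
  \<open>m\<close> on form the orbit of \<open>b^m x\<close>. The arc length
  \<open>1 / |b|^m\<close> fits \<open>prob_avoid_arc_le\<close> with
  \<open>q = b^m\<close>.\<close>

lemma prob_no_hit_add_le:
  assumes ab: "coprime a b" and b: "b \<noteq> 0" and B: "B = arc (1 / \<bar>of_int b\<bar> ^ m)"
  shows "circle.prob (no_hit a b (n + m) B)
      \<le> (1 - 1 / \<bar>of_int b\<bar> ^ m) * circle.prob (no_hit a b n B)"
proof -
  have B': "B = arc (1 / \<bar>of_int (b ^ m)\<bar>)" by (simp add: B power_abs)
  have [measurable]: "B \<in> sets borel" by (simp add: B)
  have "orbit_pt a b n k (zmul (b ^ m) x) = orbit_pt a b (n + m) (k + m) x" if "k \<le> n" for k x
    using that by (simp add: orbit_pt_def zmul_zmul power_add mult_ac)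
  moreover have "orbit_pt a b (n + m) 0 x = zmul (a ^ (n + m)) x" for x
    by (simp add: orbit_pt_def)
  ultimately have "no_hit a b (n + m) B
      \<subseteq> {x. zmul (a ^ (n + m)) x \<notin> B \<and> zmul (b ^ m) x \<in> no_hit a b n B}"
    unfolding no_hit_def by auto
  moreover have [measurable]: "no_hit a b n B \<in> sets borel" by (simp add: sets_no_hit)
  ultimately have "circle.prob (no_hit a b (n + m) B)
      \<le> circle.prob {x. zmul (a ^ (n + m)) x \<notin> B \<and> zmul (b ^ m) x \<in> no_hit a b n B}"
    by (intro circle.finite_measure_mono) (auto simp del: power_Suc)
  also have "\<dots> \<le> (1 - 1 / \<bar>of_int (b ^ m)\<bar>) * circle.prob (no_hit a b n B)"
    unfolding B' using ab b
    by (intro prob_avoid_arc_le) (auto intro!: sets_no_hit)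
  finally show ?thesis by (simp add: power_abs)
qed

lemma prob_no_hit_le_power:
  assumes ab: "coprime a b" and b: "b \<noteq> 0" and B: "B = arc (1 / \<bar>of_int b\<bar> ^ m)"
  shows "circle.prob (no_hit a b (L * m) B) \<le> (1 - 1 / \<bar>of_int b\<bar> ^ m) ^ L"
proof (induction L)
  case (Suc L)
  have "1 \<le> \<bar>real_of_int b\<bar> ^ m" using b by (intro one_le_power) linarith
  then have "0 \<le> 1 - 1 / \<bar>real_of_int b\<bar> ^ m" using b by (simp add: divide_le_eq_1)
  from mult_left_mono[OF Suc.IH this] show ?case
    using prob_no_hit_add_le[OF ab b B, of "L * m"] by (simp add: add.commute)
qed simp

section \<open>Free sets of measure close to one half\<close>

lemma free_set_abs_less:
  assumes ab: "coprime a b" and a: "a \<noteq> 0" and less: "\<bar>a\<bar> < \<bar>b\<bar>" and e: "0 < e"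
  shows "\<exists>A\<in>sets borel. eq_free a b (A :: circle set) \<and> 1 / 2 - e \<le> circle.prob A"
proof -
  have b: "b \<noteq> 0" and b2: "2 \<le> \<bar>real_of_int b\<bar>" using a less by linarith+
  have "1 / \<bar>real_of_int b\<bar> < 1" using b2 by simp
  \<comment> \<open>First \<open>m\<close> makes the arc short, and shorter than the circle; then,
    with the arc fixed, \<open>L\<close> makes a miss unlikely.\<close>
  then obtain m where m: "(1 / \<bar>real_of_int b\<bar>) ^ m < min e 1"
    using real_arch_pow_inv[of "min e 1"] e by auto
  define d where "d = 1 / \<bar>real_of_int b\<bar> ^ m"
  have d: "0 < d" "d < e" "d < 1"
    using m b by (auto simp: d_def power_divide)
  obtain L where L: "(1 - d) ^ L < e" using real_arch_pow_inv[of e "1 - d"] e d by auto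
  \<comment> \<open>The successor makes \<open>n\<close> odd.\<close>
  define n where "n = Suc (2 * L * m)"
  have "circle.prob (no_hit a b n (arc d)) \<le> circle.prob (no_hit a b (2 * L * m) (arc d))"
    unfolding n_def by (rule prob_no_hit_Suc_le[OF a sets_arc])
  also have "\<dots> \<le> (1 - d) ^ (2 * L)"
    unfolding d_def by (rule prob_no_hit_le_power[OF ab b refl])
  also have "\<dots> \<le> (1 - d) ^ L" using d by (intro power_decreasing) auto
  finally have "circle.prob (no_hit a b n (arc d)) \<le> e" using L by simp
  moreover have "circle.prob (arc d) \<le> e" using prob_arc_le[of d] d by simp
  moreover have "odd n" by (simp add: n_def)
  ultimately have "1 / 2 - e \<le> circle.prob (parity_hit a b n (arc d) False)"
    using prob_parity_hit[OF a b _ sets_arc, of n d] by simp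
  then show ?thesis
    using eq_free_parity_hit[OF ab] by (intro bexI[OF _ sets_parity_hit]) auto
qed

lemma eq_free_commute: "eq_free a b A \<longleftrightarrow> eq_free b a A"
  unfolding eq_free_def by metis

text \<open>For \<open>a = 1\<close> or \<open>a = - 1\<close> the equation says
  \<open>x + y = 0\<close>, whereas representatives in \<open>(0, 1/2)\<close> have their sum in
  \<open>(0, 1)\<close>.\<close>

lemma free_set_neg:
  fixes a :: int
  assumes "\<bar>a\<bar> = 1"
  shows "\<exists>A\<in>sets borel. eq_free a (- a) (A :: circle set) \<and> 1 / 2 \<le> circle.prob A"
proof -
  let ?A = "abs_circle ` {0<..<1/2}"
  have A: "?A \<in> sets borel" by (simp add: open_abs_circle_image)
  have "ennreal (1 / 2) = emeasure lborel {0<..<1/2::real}" by (subst emeasure_lborel_Ioo) auto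
  also have "\<dots> \<le> emeasure circle_measure ?A"
    unfolding emeasure_circle_measure[OF A]
    using measurable_sets[OF measurable_abs_circle A] by (intro emeasure_mono) auto
  finally have "1 / 2 \<le> circle.prob ?A"
    unfolding circle.emeasure_eq_measure by (subst (asm) ennreal_le_iff) auto
  moreover have "eq_free a (- a) ?A"
  proof -
    have "a = 1 \<or> a = - 1" using assms by linarith
    moreover have "r + s \<notin> \<int>" if "0 < r" "r < 1/2" "0 < s" "s < 1/2" for r s :: real
    proof
      assume "r + s \<in> \<int>"
      then obtain k where "r + s = of_int k" by (auto elim: Ints_cases)
      then have "0 < k" "k < 1" using that by linarith+
      then show False by simp
    qed
    moreover have "- r - s \<notin> \<int> \<longleftrightarrow> r + s \<notin> \<int>" for r s :: real
      by (metis minus_add_distrib minus_in_Ints_iff uminus_add_conv_diff add.commute diff_conv_add_uminus)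
    ultimately show ?thesis
      by (auto simp: eq_free_def zmul_abs_circle abs_circle_eq_iff)
  qed
  ultimately show ?thesis using A by blast
qed

lemma free_set_coprime:
  assumes ab: "coprime a b" and "a \<noteq> 0" "b \<noteq> 0" "a \<noteq> b" and e: "0 < e"
  shows "\<exists>A\<in>sets borel. eq_free a b (A :: circle set) \<and> 1 / 2 - e \<le> circle.prob A"
proof -
  consider "\<bar>a\<bar> < \<bar>b\<bar>" | "\<bar>b\<bar> < \<bar>a\<bar>" | "b = - a" using \<open>a \<noteq> b\<close> by linarith
  then show ?thesis
  proof cases
    case 1
    then show ?thesis using free_set_abs_less assms by blast
  next
    case 2
    then show ?thesis
      using free_set_abs_less[of b a e] assms by (simp add: eq_free_commute coprime_commute)
  next
    case 3
    \<comment> \<open>\<open>a\<close> divides both coprime coefficients, so it is a unit.\<close>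
    then have "\<bar>a\<bar> = 1" using ab by simp
    from free_set_neg[OF this] obtain A where
      "A \<in> sets borel" "eq_free a b (A :: circle set)" "1 / 2 \<le> circle.prob A"
      using 3 by auto
    then show ?thesis using e by (intro bexI[of _ A]) auto
  qed
qed

lemma free_set_exists:
  assumes "c1 \<noteq> 0" "c2 \<noteq> 0" "c1 \<noteq> c2" "0 < e"
  shows "\<exists>A\<in>sets borel. eq_free c1 c2 (A :: circle set) \<and> 1 / 2 - e \<le> circle.prob A"
proof -
  define g where "g = gcd c1 c2"
  have g: "g \<noteq> 0" using assms by (simp add: g_def)
  obtain a b where ab: "c1 = a * g" "c2 = b * g" "coprime a b"
    using gcd_coprime_exists[of c1 c2] g unfolding g_def by auto
  obtain A :: "circle set" where A: "A \<in> sets borel" "eq_free a b A" "1 / 2 - e \<le> circle.prob A"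
    using free_set_coprime[OF ab(3)] assms ab by auto
  \<comment> \<open>\<open>zmul g\<close> sends solutions for \<open>c1, c2\<close> to solutions for
    \<open>a, b\<close>.\<close>
  have "eq_free c1 c2 (zmul g -` A)"
    using A(2) by (auto simp: eq_free_def ab zmul_zmul[symmetric])
  then show ?thesis
    using A g by (intro bexI[OF _ sets_zmul_vimage[OF A(1), of g]]) (simp add: prob_zmul_vimage)
qed

theorem proposition1p4:
  fixes c1 c2 :: int
  assumes "c1 \<noteq> 0" and "c2 \<noteq> 0" and "c1 \<noteq> c2"
  shows "d_free c1 c2 TYPE(circle) = 1 / 2"
proof -
  let ?S = "{circle.prob A | A :: circle set. A \<in> sets borel \<and> eq_free c1 c2 A}"
  have le: "x \<le> 1 / 2" if "x \<in> ?S" for x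
    using that eq_free_prob_le[OF assms(1,2)] by auto
  have "Sup ?S = 1 / 2"
  proof (rule antisym)
    show "Sup ?S \<le> 1 / 2"
      using eq_free_empty by (intro cSup_least le) auto
    show "1 / 2 \<le> Sup ?S"
    proof (rule field_le_epsilon)
      fix e :: real assume "0 < e"
      then obtain A :: "circle set" where
        A: "A \<in> sets borel" "eq_free c1 c2 A" "1 / 2 - e \<le> circle.prob A"
        using free_set_exists[OF assms] by blast
      have "circle.prob A \<le> Sup ?S"
        using A le by (intro cSup_upper bdd_aboveI) auto
      then show "1 / 2 \<le> Sup ?S + e" using A(3) by simp
    qed
  qed
  then show ?thesis by (simp add: d_free_def haar_circle)
qed

end
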